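(* The price of anarchy, with respect to liquid welfare, of mixed Nash equilibria of simultaneous first-price auctions with budget-constrained bidders under the restricted uniform bidding interface is at least $$\frac{2+\mathcal W_0(-e^{-2})}{1+\mathcal W_0(-e^{-2})}\approx2.188.$$ That is, the supremum of $\mathrm{OPT}(I)/\mathrm{LW}(I,A)$ over all such instances $I$ and all mixed Nash equilibria $A$ of $I$ is at least this number.
   Context: $\mathcal W_0$ is the principal real branch of the Lambert function: $\mathcal W_0(-e^{-2})$ is the unique $w\in[-1,0)$ with $we^w=-e^{-2}$. Uniform bidding interface: bidders $N=[n]$, $n\ge2$; items $M=[m]$, $m\ge1$. Bidder $i$ has an additive valuation $v_i(S)=\sum_{j\in S}v_{ij}$, $v_{ij}\ge0$, and a budget $B_i\in(0,\infty]$. The action of bidder $i$ is a single bid multiplier $\alpha_i\in\mathcal A_i=[0,1]$, which induces the bid $\alpha_iv_{ij}$ on each item $j$; $\mathcal A=[0,1]^n$. Each item $j$ is awarded to exactly one bidder among those with the highest bid on $j$, ties being resolved by a fixed order over bidders (part of the instance); $X_i(\alpha)\subseteq M$ is the set of items won by $i$ and $i$ pays (first-price) $P_i(\alpha)=\sum_{j\in X_i(\alpha)}\alpha_iv_{ij}$. Utility: $u_i=v_i(X_i)-P_i$. The feasible allocations $\mathcal X$ are the profiles $(x_i)_{i\in N}$ of pairwise disjoint subsets of $M$. $\Delta(S)$ denotes probability distributions on $S$. A mixed Nash equilibrium is a product distribution $A=\prod_iA_i$, $A_i\in\Delta(\mathcal A_i)$, such that for all $i$: $\mathbb E_{a\sim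 A}[P_i(a)]\le B_i$, and $\mathbb E_{a\sim A}[u_i(a)]\ge\mathbb E_{a_i'\sim A_i',a_{-i}\sim A_{-i}}[u_i(a_i',a_{-i})]$ for every $A_i'\in\Delta(\mathcal A_i)$ with $\mathbb E_{a_i'\sim A_i',a_{-i}\sim A_{-i}}[P_i(a_i',a_{-i})]\le B_i$. $\mathrm{LW}(I,A)=\sum_i\min\{\mathbb E_{a\sim A}[v_i(X_i(a))],B_i\}$ and $\mathrm{OPT}(I)=\max_{\chi\in\Delta(\mathcal X)}\sum_i\min\{\mathbb E_{x\sim\chi}[v_i(x_i)],B_i\}$. *)

theory Defs
  imports "HOL-Probability.Probability"
begin

text \<open>The principal real branch of the Lambert function on \<open>[-1/e, \<infinity>)\<close>.\<close>

definition lambert_W0 :: "real \<Rightarrow> real" where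
  "lambert_W0 x = (THE w. - 1 \<le> w \<and> w * exp w = x)"

lemma lambert_W0_arg:
  shows "\<exists>!w::real. - 1 \<le> w \<and> w * exp w = - exp (- 2)"
    and "\<exists>!w::real. w \<in> {- 1..<0} \<and> w * exp w = - exp (- 2)"
    and "lambert_W0 (- exp (- 2)) = (THE w. w \<in> {- 1..<0} \<and> w * exp w = - exp (- 2))"
proof -
  let ?f = "\<lambda>w::real. w * exp w"
  have mono: "?f x < ?f y" if "- 1 \<le> x" "x < y" for x y :: real
  proof (rule DERIV_pos_imp_increasing_open[OF \<open>x < y\<close>])
    fix z :: real assume "x < z" "z < y"
    then have "0 < (1 + z) * exp z" using that by simp
    moreover have "DERIV ?f z :> (1 + z) * exp z"
      by (auto intro!: derivative_eq_intros simp: algebra_simps)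
    ultimately show "\<exists>d. DERIV ?f z :> d \<and> 0 < d" by blast
  qed (intro continuous_intros)
  have cont: "continuous_on {- 1..0} ?f" by (intro continuous_intros)
  have minus2: "- exp (- 1) \<le> - exp (- 2 :: real)" "- exp (- 2 :: real) \<le> 0" by simp_all
  have "\<exists>w. - 1 \<le> w \<and> w \<le> 0 \<and> ?f w = - exp (- 2)"
    using IVT'[of ?f "- 1" "- exp (- 2)" 0] minus2 cont by simp
  then obtain w where w: "- 1 \<le> w" "w \<le> 0" "?f w = - exp (- 2)" by blast
  have neg: "w < 0"
    using w(2,3) exp_gt_zero[of "- 2 :: real"] by (metis less_eq_real_def mult_zero_left neg_equal_0_iff_equal exp_not_eq_zero)
  have uniq: "u = w" if "- 1 \<le> u" "?f u = - exp (- 2)" for u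
  proof (rule ccontr)
    assume "u \<noteq> w"
    then consider "u < w" | "w < u" by linarith
    then show False
    proof cases
      case 1
      then show False using mono[OF that(1) 1] that(2) w(3) by linarith
    next
      case 2
      then show False using mono[OF w(1) 2] that(2) w(3) by linarith
    qed
  qed
  have w': "w \<in> {- 1..<0} \<and> w * exp w = - exp (- 2)"
    using w(1,3) neg by simp
  have uniq': "u = w" if "u \<in> {- 1..<0} \<and> u * exp u = - exp (- 2)" for u
    by (rule uniq) (use that in simp_all)
  show "\<exists>!w::real. - 1 \<le> w \<and> w * exp w = - exp (- 2)"
    using conjI[OF w(1,3)] by (rule ex1I) (elim conjE, rule uniq)
  show "\<exists>!w::real. w \<in> {- 1..<0} \<and> w * exp w = - exp (- 2)"
    using w' by (rule ex1I) (rule uniq')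
  have "lambert_W0 (- exp (- 2)) = w"
    unfolding lambert_W0_def
    using conjI[OF w(1,3)] by (rule the_equality) (elim conjE, rule uniq)
  moreover have "(THE w. w \<in> {- 1..<0} \<and> w * exp w = - exp (- 2)) = w"
    using w' by (rule the_equality) (rule uniq')
  ultimately show "lambert_W0 (- exp (- 2)) = (THE w. w \<in> {- 1..<0} \<and> w * exp w = - exp (- 2))"
    by (rule trans[OF _ sym])
qed


text \<open>
  Bidders and items are numbered from 0. \<open>(i, k) \<in> tie_order I\<close> means that
  bidder \<open>i\<close> has priority over bidder \<open>k\<close> in case of a tie.
\<close>

record auction =
  num_bidders :: nat
  num_items :: nat
  value_of :: "nat \<Rightarrow> nat \<Rightarrow> real"
  budget :: "nat \<Rightarrow> ereal"
  tie_order :: "(nat \<times> nat) set"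

definition bidders :: "auction \<Rightarrow> nat set" where
  "bidders I = {..<num_bidders I}"

definition items :: "auction \<Rightarrow> nat set" where
  "items I = {..<num_items I}"

definition valid_auction :: "auction \<Rightarrow> bool" where
  "valid_auction I \<longleftrightarrow>
     2 \<le> num_bidders I \<and> 1 \<le> num_items I \<and>
     (\<forall>i\<in>bidders I. \<forall>j\<in>items I. 0 \<le> value_of I i j) \<and>
     (\<forall>i\<in>bidders I. 0 < budget I i) \<and>
     linear_order_on (bidders I) (tie_order I)"

definition valuation :: "auction \<Rightarrow> nat \<Rightarrow> nat set \<Rightarrow> real" where
  "valuation I i S = (\<Sum>j\<in>S. value_of I i j)"

definition bid :: "auction \<Rightarrow> (nat \<Rightarrow> real) \<Rightarrow> nat \<Rightarrow> nat \<Rightarrow> real" where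
  "bid I a i j = a i * value_of I i j"

definition highest_bidders :: "auction \<Rightarrow> (nat \<Rightarrow> real) \<Rightarrow> nat \<Rightarrow> nat set" where
  "highest_bidders I a j = {i \<in> bidders I. \<forall>k\<in>bidders I. bid I a k j \<le> bid I a i j}"

definition won_items :: "auction \<Rightarrow> (nat \<Rightarrow> real) \<Rightarrow> nat \<Rightarrow> nat set" where
  "won_items I a i =
     {j \<in> items I. i \<in> highest_bidders I a j \<and>
                   (\<forall>k\<in>highest_bidders I a j. (i, k) \<in> tie_order I)}"

definition payment :: "auction \<Rightarrow> (nat \<Rightarrow> real) \<Rightarrow> nat \<Rightarrow> real" where
  "payment I a i = (\<Sum>j\<in>won_items I a i. bid I a i j)"

definition utility :: "auction \<Rightarrow> (nat \<Rightarrow> real) \<Rightarrow> nat \<Rightarrow> real" where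
  "utility I a i = valuation I i (won_items I a i) - payment I a i"


text \<open>Borel probability measures on the action space \<open>[0,1]\<close>.\<close>

definition mixed_actions :: "real measure set" where
  "mixed_actions = space (prob_algebra (restrict_space borel {0..1}))"

definition expect ::
    "auction \<Rightarrow> (nat \<Rightarrow> real measure) \<Rightarrow> ((nat \<Rightarrow> real) \<Rightarrow> real) \<Rightarrow> real" where
  "expect I A f = (\<integral>a. f a \<partial>(\<Pi>\<^sub>M i\<in>bidders I. A i))"

definition mixed_nash :: "auction \<Rightarrow> (nat \<Rightarrow> real measure) \<Rightarrow> bool" where
  "mixed_nash I A \<longleftrightarrow>
     (\<forall>i\<in>bidders I. A i \<in> mixed_actions) \<and>
     (\<forall>i\<in>bidders I.
        ereal (expect I A (\<lambda>a. payment I a i)) \<le> budget I i \<and>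
        (\<forall>D\<in>mixed_actions.
           ereal (expect I (A(i := D)) (\<lambda>a. payment I a i)) \<le> budget I i \<longrightarrow>
           expect I (A(i := D)) (\<lambda>a. utility I a i) \<le> expect I A (\<lambda>a. utility I a i)))"

definition liquid_welfare :: "auction \<Rightarrow> (nat \<Rightarrow> real measure) \<Rightarrow> ereal" where
  "liquid_welfare I A =
     (\<Sum>i\<in>bidders I. min (ereal (expect I A (\<lambda>a. valuation I i (won_items I a i)))) (budget I i))"

definition allocations :: "auction \<Rightarrow> (nat \<Rightarrow> nat set) set" where
  "allocations I =
     {x \<in> bidders I \<rightarrow>\<^sub>E Pow (items I). disjoint_family_on x (bidders I)}"

text \<open>
  The supremum is a maximum, because \<open>allocations I\<close> is finite and the
  objective is continuous on the simplex of distributions over it.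
\<close>

definition opt_liquid_welfare :: "auction \<Rightarrow> ereal" where
  "opt_liquid_welfare I =
     (SUP p\<in>{p. set_pmf p \<subseteq> allocations I}.
        (\<Sum>i\<in>bidders I.
           min (ereal (measure_pmf.expectation p (\<lambda>x. valuation I i (x i)))) (budget I i)))"

text \<open>
  The quotient is taken in \<open>ereal\<close>, where \<open>0 / 0 = 0\<close> and
  \<open>c / 0 = \<infinity>\<close> for \<open>c > 0\<close>.
\<close>

definition price_of_anarchy :: ereal where
  "price_of_anarchy =
     (SUP (I, A)\<in>{(I, A). valid_auction I \<and> mixed_nash I A}.
        opt_liquid_welfare I / liquid_welfare I A)"

end

theory Submission
  imports Defs "HOL-Real_Asymp.Real_Asymp"
begin

text \<open>
  Write \<open>W\<^sub>0(-e\<^sup>-\<^sup>2) = -u\<close>, so that \<open>ln u = u - 2\<close>. The bound is approached by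
  pure equilibria with three bidders. Bidder 0 has no budget and total value 1 for the items
  \<open>0, \<dots>, K\<close>; the price of item \<open>k\<close> per unit of its value is \<open>x k\<close>, and the value it gets at
  prices up to \<open>\<beta>\<close> is at most \<open>u / (1 - \<beta>)\<close>, so that it may as well bid 0 and win value \<open>u\<close> only.
  These prices are set by bidder 1, who bids a tiny multiplier \<open>\<alpha>\<close> and has huge values for these
  items. It does not lower \<open>\<alpha>\<close> because it would lose one further item, of value equal to its budget
  \<open>B\<close>, to bidder 2, whose value for it is \<open>\<alpha> B\<close>. The payments of bidder 1 exhaust \<open>B\<close>, hence the
  equilibrium has liquid welfare \<open>u + B\<close>, whereas giving bidder 1 only the further item and bidder 0
  the rest achieves \<open>1 + B\<close>. In the limit of fine prices \<open>B\<close> is \<open>1 - u + u ln u\<close>, and the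
  ratio \<open>(1 + B) / (u + B)\<close> is largest exactly at \<open>ln u = u - 2\<close>.
\<close>

section \<open>Pure equilibria\<close>

abbreviation action_space :: "real measure" where
  "action_space \<equiv> restrict_space borel {0..1}"

text \<open>The point mass lives on \<open>action_space\<close>, because
  \<open>mixed_actions\<close> fixes this sigma-algebra.\<close>

definition pure_profile :: "(nat \<Rightarrow> real) \<Rightarrow> nat \<Rightarrow> real measure" where
  "pure_profile a i = return action_space (a i)"

text \<open>Points of the product space are tied to a given profile at bidders only, so outcomes
  must not depend on values elsewhere.\<close>

lemma won_items_cong:
  assumes "\<And>k. k \<in> bidders I \<Longrightarrow> a k = b k"
  shows "won_items I a i = won_items I b i"
proof -
  have "highest_bidders I a j = highest_bidders I b j" for j
    using assms by (auto simp: highest_bidders_def bid_def)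
  then show ?thesis by (simp add: won_items_def)
qed

lemma payment_cong:
  assumes "\<And>k. k \<in> bidders I \<Longrightarrow> a k = b k" "i \<in> bidders I"
  shows "payment I a i = payment I b i"
  using assms won_items_cong[OF assms(1)] by (simp add: payment_def bid_def)

lemma utility_eq: "utility I a i = (1 - a i) * valuation I i (won_items I a i)"
  by (simp add: utility_def payment_def valuation_def bid_def sum_distrib_left left_diff_distrib sum_subtractf)

lemma utility_cong:
  assumes "\<And>k. k \<in> bidders I \<Longrightarrow> a k = b k" "i \<in> bidders I"
  shows "utility I a i = utility I b i"
  using assms won_items_cong[OF assms(1)] by (simp add: utility_eq)

lemma finite_bidders [simp]: "finite (bidders I)"
  by (simp add: bidders_def)

lemma finite_items [simp]: "finite (items I)"
  by (simp add: items_def)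

section \<open>Measurability of the outcomes\<close>

lemma measurable_won_items:
  fixes N :: "nat \<Rightarrow> real measure"
  assumes N: "\<And>k. k \<in> bidders I \<Longrightarrow> sets (N k) = sets action_space" and i: "i \<in> bidders I"
  shows "Measurable.pred (PiM (bidders I) N) (\<lambda>a. j \<in> won_items I a i)"
    and "(\<lambda>a. a i) \<in> borel_measurable (PiM (bidders I) N)"
proof -
  have comp: "(\<lambda>a. a k) \<in> borel_measurable (PiM (bidders I) N)" if k: "k \<in> bidders I" for k
  proof -
    have id: "(\<lambda>x. x) \<in> measurable (N k) borel"
      unfolding measurable_cong_sets[OF N[OF k] refl]
      by (rule measurable_restrict_space1) simp
    show ?thesis
      by (rule measurable_compose[OF measurable_component_singleton[OF k, of N] id])
  qed
  have cmp: "Measurable.pred (PiM (bidders I) N) (\<lambda>a. bid I a k j \<le> bid I a l j)"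
    if "k \<in> bidders I" "l \<in> bidders I" for k l
    unfolding pred_def bid_def using that
    by (intro borel_measurable_le borel_measurable_times borel_measurable_const comp)
  have high: "Measurable.pred (PiM (bidders I) N) (\<lambda>a. l \<in> highest_bidders I a j)"
    if "l \<in> bidders I" for l
    using cmp that by (auto simp: highest_bidders_def intro!: pred_intros_finite)
  \<comment> \<open>The quantifier over \<open>highest_bidders I a j\<close>, which varies with
    \<open>a\<close>, becomes one over the fixed finite set of bidders.\<close>
  have eq: "(j \<in> won_items I a i) \<longleftrightarrow> j \<in> items I \<and> i \<in> highest_bidders I a j \<and>
      (\<forall>k\<in>bidders I. k \<in> highest_bidders I a j \<longrightarrow> (i, k) \<in> tie_order I)" for a
    by (auto simp: won_items_def highest_bidders_def)
  show "Measurable.pred (PiM (bidders I) N) (\<lambda>a. j \<in> won_items I a i)"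
    unfolding eq using high i by (intro pred_intros_logic pred_intros_finite) auto
  show "(\<lambda>a. a i) \<in> borel_measurable (PiM (bidders I) N)" by (rule comp[OF i])
qed

text \<open>Indicators turn the sum over a set depending on \<open>a\<close> into a sum over a fixed
  set, which reduces measurability to that of the winning events.\<close>

lemma valuation_won_items_eq:
  "valuation I i (won_items I a i) =
    (\<Sum>j\<in>items I. value_of I i j * indicator {a. j \<in> won_items I a i} a)"
proof -
  have "items I \<inter> won_items I a i = won_items I a i" by (auto simp: won_items_def)
  then have "valuation I i (won_items I a i) = (\<Sum>j\<in>items I \<inter> won_items I a i. value_of I i j)"
    by (simp add: valuation_def)
  also have "\<dots> = (\<Sum>j\<in>items I. if j \<in> won_items I a i then value_of I i j else 0)"
    by (rule sum.inter_restrict) simp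
  also have "\<dots> = (\<Sum>j\<in>items I. value_of I i j * indicator {a. j \<in> won_items I a i} a)"
    by (intro sum.cong) (auto simp: indicator_def)
  finally show ?thesis .
qed

lemma measurable_outcomes:
  fixes N :: "nat \<Rightarrow> real measure"
  assumes N: "\<And>k. k \<in> bidders I \<Longrightarrow> sets (N k) = sets action_space" and i: "i \<in> bidders I"
  shows "(\<lambda>a. valuation I i (won_items I a i)) \<in> borel_measurable (PiM (bidders I) N)"
    and "(\<lambda>a. payment I a i) \<in> borel_measurable (PiM (bidders I) N)"
    and "(\<lambda>a. utility I a i) \<in> borel_measurable (PiM (bidders I) N)"
proof -
  have [measurable]: "Measurable.pred (PiM (bidders I) N) (\<lambda>a. j \<in> won_items I a i)" for j
    by (rule measurable_won_items(1)[OF N i])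
  have [measurable]: "(\<lambda>a. a i) \<in> borel_measurable (PiM (bidders I) N)"
    by (rule measurable_won_items(2)[OF N i])
  show 1 [measurable]: "(\<lambda>a. valuation I i (won_items I a i)) \<in> borel_measurable (PiM (bidders I) N)"
    unfolding valuation_won_items_eq by measurable
  have "payment I a i = a i * valuation I i (won_items I a i)" for a
    by (simp add: payment_def valuation_def bid_def sum_distrib_left)
  then show "(\<lambda>a. payment I a i) \<in> borel_measurable (PiM (bidders I) N)" by simp
  show "(\<lambda>a. utility I a i) \<in> borel_measurable (PiM (bidders I) N)"
    unfolding utility_eq by measurable
qed

section \<open>Expectations under point masses\<close>

lemma pure_profile_action:
  assumes "a i \<in> {0..1}"
  shows "pure_profile a i \<in> mixed_actions" "prob_space (pure_profile a i)"
    "sets (pure_profile a i) = sets action_space"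
    "AE y in pure_profile a i. y = a i"
proof -
  have sp: "a i \<in> space action_space" using assms by (simp add: space_restrict_space)
  show p: "prob_space (pure_profile a i)"
    unfolding pure_profile_def by (rule prob_space_return[OF sp])
  show s: "sets (pure_profile a i) = sets action_space" by (simp add: pure_profile_def)
  show "pure_profile a i \<in> mixed_actions" using p s by (simp add: mixed_actions_def space_prob_algebra)
  have "{y \<in> space action_space. y = a i} \<in> sets action_space"
    using assms by (auto simp: sets_restrict_space space_restrict_space intro!: image_eqI[of _ _ "{a i}"])
  then show "AE y in pure_profile a i. y = a i"
    unfolding pure_profile_def by (subst AE_return[OF sp]) (auto simp: pred_def)
qed

lemma mixed_actionsD:
  assumes "D \<in> mixed_actions"
  shows "prob_space D" "sets D = sets action_space" "space D = {0..1}"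
  using assms sets_eq_imp_space_eq[of D action_space]
  by (auto simp: mixed_actions_def space_prob_algebra space_restrict_space)

text \<open>Almost every point of a product of point masses agrees with \<open>a\<close> on all
  bidders, so \<open>f\<close> is almost surely the constant \<open>f a\<close>.\<close>

lemma expect_pure_profile:
  assumes a: "\<And>k. k \<in> bidders I \<Longrightarrow> a k \<in> {0..1}"
    and f: "f \<in> borel_measurable (PiM (bidders I) (pure_profile a))"
    and cong: "\<And>b. (\<And>k. k \<in> bidders I \<Longrightarrow> b k = a k) \<Longrightarrow> f b = f a"
  shows "expect I (pure_profile a) f = f a"
proof -
  have prob: "\<And>k. k \<in> bidders I \<Longrightarrow> prob_space (pure_profile a k)"
    using pure_profile_action a by blast
  interpret prob_space "PiM (bidders I) (pure_profile a)"
    by (rule prob_space_PiM) (rule prob)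
  have "AE b in PiM (bidders I) (pure_profile a). \<forall>k\<in>bidders I. b k = a k"
    by (subst AE_ball_countable)
       (auto intro!: countable_finite AE_PiM_component prob pure_profile_action a)
  then have "AE b in PiM (bidders I) (pure_profile a). f b = f a"
    by eventually_elim (rule cong, simp)
  then have "expect I (pure_profile a) f = (\<integral>b. f a \<partial>PiM (bidders I) (pure_profile a))"
    unfolding expect_def using f by (intro integral_cong_AE) auto
  then show ?thesis by (simp add: prob_space)
qed

lemma expect_pure_outcomes:
  assumes "\<And>k. k \<in> bidders I \<Longrightarrow> a k \<in> {0..1}" "i \<in> bidders I"
  shows "expect I (pure_profile a) (\<lambda>a. valuation I i (won_items I a i)) =
      valuation I i (won_items I a i)"
    and "expect I (pure_profile a) (\<lambda>a. payment I a i) = payment I a i"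
    and "expect I (pure_profile a) (\<lambda>a. utility I a i) = utility I a i"
  using assms
  by (auto intro!: expect_pure_profile measurable_outcomes pure_profile_action payment_cong utility_cong
      arg_cong[where f = "valuation I i"] won_items_cong)

text \<open>
  The integral of a function that is not integrable is 0, so that a pointwise bound on the utility
  of a deviation by the nonnegative equilibrium utility bounds its expectation in any case.
\<close>

lemma mixed_nash_pure_profile:
  assumes nonneg: "\<And>i j. i \<in> bidders I \<Longrightarrow> j \<in> items I \<Longrightarrow> 0 \<le> value_of I i j"
    and a: "\<And>i. i \<in> bidders I \<Longrightarrow> a i \<in> {0..1}"
    and budget: "\<And>i. i \<in> bidders I \<Longrightarrow> ereal (payment I a i) \<le> budget I i"
    and opt: "\<And>i y. i \<in> bidders I \<Longrightarrow> y \<in> {0..1} \<Longrightarrow> utility I (a(i := y)) i \<le> utility I a i"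
  shows "mixed_nash I (pure_profile a)"
proof -
  have dev: "expect I ((pure_profile a)(i := D)) (\<lambda>a. utility I a i) \<le> utility I a i"
    if i: "i \<in> bidders I" and D: "D \<in> mixed_actions" for i D
  proof -
    let ?A = "(pure_profile a)(i := D)"
    have prob: "\<And>k. k \<in> bidders I \<Longrightarrow> prob_space (?A k)"
      using pure_profile_action a mixed_actionsD(1)[OF D] by simp
    interpret prob_space "PiM (bidders I) ?A"
      by (rule prob_space_PiM) (rule prob)
    \<comment> \<open>The other bidders still play point masses, so the profile is almost surely a
      pure deviation of bidder \<open>i\<close>.\<close>
    have "AE b in PiM (bidders I) ?A. k \<noteq> i \<longrightarrow> b k = a k" if "k \<in> bidders I" for k
    proof (cases "k = i")
      case False
      then have "?A k = pure_profile a k" by simp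
      then have "AE y in ?A k. y = a k"
        using pure_profile_action(4)[of a k, OF a[OF that]] by (simp only:)
      from AE_PiM_component[of "bidders I" ?A, OF prob that this] show ?thesis by simp
    qed simp
    then have "AE b in PiM (bidders I) ?A. \<forall>k\<in>bidders I. k \<noteq> i \<longrightarrow> b k = a k"
      by (intro AE_finite_allI) auto
    moreover have "AE b in PiM (bidders I) ?A. b i \<in> {0..1}"
      using mixed_actionsD(3)[OF D] i
      by (intro AE_PiM_component prob) (auto intro!: AE_I2)
    ultimately have le: "AE b in PiM (bidders I) ?A. utility I b i \<le> utility I a i"
    proof eventually_elim
      fix b assume b: "\<forall>k\<in>bidders I. k \<noteq> i \<longrightarrow> b k = a k" "b i \<in> {0..1}"
      have "utility I b i = utility I (a(i := b i)) i"
        using b i by (intro utility_cong) auto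
      also have "\<dots> \<le> utility I a i" using opt i b by blast
      finally show "utility I b i \<le> utility I a i" .
    qed
    have ge: "0 \<le> utility I a i"
      using a[OF i] nonneg[OF i]
      by (auto simp: utility_eq valuation_def won_items_def intro!: mult_nonneg_nonneg sum_nonneg)
    show ?thesis
    proof (cases "integrable (PiM (bidders I) ?A) (\<lambda>b. utility I b i)")
      case True
      then show ?thesis
        unfolding expect_def by (intro integral_le_const le)
    next
      case False
      then show ?thesis
        unfolding expect_def using ge by (simp add: not_integrable_integral_eq)
    qed
  qed
  show ?thesis
    unfolding mixed_nash_def
    using pure_profile_action(1) a budget dev by (simp add: expect_pure_outcomes)
qed

section \<open>Bounds from a single equilibrium and a single allocation\<close>

lemma price_of_anarchy_ge:
  assumes "valid_auction I" "mixed_nash I A"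
  shows "opt_liquid_welfare I / liquid_welfare I A \<le> price_of_anarchy"
  unfolding price_of_anarchy_def
  by (rule SUP_upper2[of "(I, A)"]) (use assms in auto)

lemma opt_liquid_welfare_ge:
  assumes "x \<in> allocations I"
  shows "(\<Sum>i\<in>bidders I. min (ereal (valuation I i (x i))) (budget I i)) \<le> opt_liquid_welfare I"
  unfolding opt_liquid_welfare_def
  by (rule SUP_upper2[of "return_pmf x"]) (use assms in auto)

section \<open>The instances\<close>

lemma linear_order_on_lessThan: "linear_order_on {..<n} {(i, k). i \<le> k \<and> k < (n :: nat)}"
  by (auto simp: linear_order_on_def partial_order_on_def preorder_on_def refl_on_def
      trans_def antisym_def total_on_def)

text \<open>
  \<open>w k\<close> is the value of bidder 0 for item \<open>k \<le> K\<close>, and \<open>x k\<close> is the price of the item per unit of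
  this value.
\<close>

locale lower_bound_instance =
  fixes K :: nat and w x :: "nat \<Rightarrow> real" and \<alpha> B :: real
  assumes \<alpha>: "0 < \<alpha>" "\<alpha> < 1"
    and w_pos: "\<And>k. k \<le> K \<Longrightarrow> 0 < w k"
    and x_0: "x 0 = 0"
    and x_pos: "\<And>k. 0 < k \<Longrightarrow> k \<le> K \<Longrightarrow> 0 < x k"
    and sum_w: "(\<Sum>k\<le>K. w k) = 1"
    and B_pos: "0 < B"
    and B_eq: "(\<Sum>k\<le>K. w k * x k) = (1 - \<alpha>) * B"
    and utility_w: "\<And>\<beta>. 0 \<le> \<beta> \<Longrightarrow> \<beta> \<le> 1 \<Longrightarrow> (1 - \<beta>) * (\<Sum>k | k \<le> K \<and> x k \<le> \<beta>. w k) \<le> w 0"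
begin

declare One_nat_def [simp del]

text \<open>With multiplier \<open>\<alpha>\<close>, bidder 1 bids \<open>w k * x k\<close> on item
  \<open>k\<close>, so bidder 0 needs at least the multiplier \<open>x k\<close> to win it. On the
  further item \<open>Suc K\<close> bidder 1 bids \<open>\<alpha> * B\<close>, which bidder 2 just
  matches by bidding its full value.\<close>

definition val :: "nat \<Rightarrow> nat \<Rightarrow> real" where
  "val i k =
    (if i = 0 then if k \<le> K then w k else 0
     else if i = 1 then if k \<le> K then w k * x k / \<alpha> else B
     else if k \<le> K then 0 else \<alpha> * B)"

text \<open>Priority of smaller indices lets bidder 0 win at exactly the price, in particular item 0
  with bid 0, and lets bidder 1 keep item \<open>Suc K\<close> in the tie with bidder 2.\<close>

definition inst :: auction where
  "inst = \<lparr>num_bidders = 3, num_items = K + 2, value_of = val,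
     budget = (\<lambda>i. if i = 1 then ereal B else \<infinity>),
     tie_order = {(i, k). i \<le> k \<and> k < 3}\<rparr>"

definition profile :: "nat \<Rightarrow> real" where
  "profile = (\<lambda>i. if i = 0 then 0 else if i = 1 then \<alpha> else 1)"

lemma profile_simps [simp]: "profile 0 = 0" "profile 1 = \<alpha>" "profile 2 = 1"
  by (simp_all add: profile_def)

lemma bidders_inst [simp]: "bidders inst = {0, 1, 2}"
  by (auto simp: bidders_def inst_def)

lemma items_inst [simp]: "items inst = insert (Suc K) {..K}"
  by (auto simp: items_def inst_def)

lemma budget_inst [simp]: "budget inst i = (if i = 1 then ereal B else \<infinity>)"
  by (simp add: inst_def)

lemma tie_order_inst [simp]: "tie_order inst = {(i, k). i \<le> k \<and> k < 3}"
  by (simp add: inst_def)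

lemma value_of_inst: "value_of inst = val"
  by (simp add: inst_def)

lemma num_inst: "num_bidders inst = 3" "num_items inst = K + 2"
  by (simp_all add: inst_def)

lemma bid_inst: "bid inst a i j = a i * val i j"
  by (simp add: bid_def inst_def)

lemma valuation_inst: "valuation inst i S = (\<Sum>j\<in>S. val i j)"
  by (simp add: valuation_def inst_def)

lemma x_nonneg: "k \<le> K \<Longrightarrow> 0 \<le> x k"
  using x_pos[of k] x_0 by (cases "k = 0") auto

lemma val_nonneg: "0 \<le> val i k"
  using \<alpha> B_pos by (auto simp: val_def intro!: divide_nonneg_pos mult_nonneg_nonneg x_nonneg less_imp_le[OF w_pos])

lemma valid_inst: "valid_auction inst"
proof -
  have "{0, 1, 2 :: nat} = {..<3}" by auto
  then have "linear_order_on (bidders inst) (tie_order inst)"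
    by (simp only: bidders_inst tie_order_inst linear_order_on_lessThan)
  then show ?thesis
    using val_nonneg B_pos unfolding valid_auction_def
    by (simp add: num_inst value_of_inst)
qed

lemma won_items_inst:
  "won_items inst a 0 = {j. j \<le> Suc K \<and> bid inst a 1 j \<le> bid inst a 0 j \<and> bid inst a 2 j \<le> bid inst a 0 j}"
  "won_items inst a 1 = {j. j \<le> Suc K \<and> bid inst a 0 j < bid inst a 1 j \<and> bid inst a 2 j \<le> bid inst a 1 j}"
  "won_items inst a 2 = {j. j \<le> Suc K \<and> bid inst a 0 j < bid inst a 2 j \<and> bid inst a 1 j < bid inst a 2 j}"
proof -
  have "won_items inst a i = {j. j \<le> Suc K \<and>
      (\<forall>k\<in>{0, 1, 2}. bid inst a k j \<le> bid inst a i j \<and> (k < i \<longrightarrow> bid inst a k j < bid inst a i j))}"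
    if i: "i \<in> {0, 1, 2}" for i
  proof (rule set_eqI)
    fix j
    let ?b = "\<lambda>k. bid inst a k j"
    have "j \<in> won_items inst a i \<longleftrightarrow> j \<le> Suc K \<and> (\<forall>k\<in>{0, 1, 2}. ?b k \<le> ?b i) \<and>
        (\<forall>k\<in>{0, 1, 2}. (\<forall>l\<in>{0, 1, 2}. ?b l \<le> ?b k) \<longrightarrow> i \<le> k)"
      using i unfolding won_items_def highest_bidders_def bidders_inst items_inst tie_order_inst
      by (auto simp only: mem_Collect_eq split_conv le_Suc_eq insert_iff atMost_iff)
    \<comment> \<open>A bidder \<open>k < i\<close> whose bid equals the highest bid of
      \<open>i\<close> would itself be a highest bidder with priority over \<open>i\<close>.\<close>
    also have "\<dots> \<longleftrightarrow> j \<le> Suc K \<and> (\<forall>k\<in>{0, 1, 2}. ?b k \<le> ?b i \<and> (k < i \<longrightarrow> ?b k < ?b i))"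
      using i by (meson dual_order.trans le_less_trans less_irrefl not_le)
    finally show "j \<in> won_items inst a i \<longleftrightarrow> j \<in> {j. j \<le> Suc K \<and>
        (\<forall>k\<in>{0, 1, 2}. bid inst a k j \<le> bid inst a i j \<and> (k < i \<longrightarrow> bid inst a k j < bid inst a i j))}"
      by simp
  qed
  from this[of 0] this[of 1] this[of 2]
  show "won_items inst a 0 = {j. j \<le> Suc K \<and> bid inst a 1 j \<le> bid inst a 0 j \<and> bid inst a 2 j \<le> bid inst a 0 j}"
    "won_items inst a 1 = {j. j \<le> Suc K \<and> bid inst a 0 j < bid inst a 1 j \<and> bid inst a 2 j \<le> bid inst a 1 j}"
    "won_items inst a 2 = {j. j \<le> Suc K \<and> bid inst a 0 j < bid inst a 2 j \<and> bid inst a 1 j < bid inst a 2 j}"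
    by (simp_all add: less_imp_le conj_commute cong: conj_cong)
qed

text \<open>\<open>a 0\<close> is left free, to cover the equilibrium and all deviations of bidder
  0.\<close>

lemma won_0:
  assumes "a 1 = \<alpha>" "a 2 = 1"
  shows "won_items inst a 0 = {k. k \<le> K \<and> x k \<le> a 0}"
proof -
  have "j \<in> won_items inst a 0 \<longleftrightarrow> j \<le> K \<and> x j \<le> a 0" for j
  proof (cases "j \<le> K")
    case True
    then show ?thesis
      using w_pos[OF True] \<alpha> x_nonneg[OF True] assms
      by (auto simp: won_items_inst bid_inst val_def mult.commute[of _ "w j"])
  next
    case False
    then show ?thesis
      using B_pos \<alpha> assms by (auto simp: won_items_inst bid_inst val_def mult_le_0_iff)
  qed
  then show ?thesis by blast
qed

text \<open>The two values make bidder 1 indifferent: keeping the fraction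
  \<open>1 - \<alpha>\<close> of the second is the same as getting the first for free.\<close>

lemma valuation_1:
  "valuation inst 1 {..K} = (1 - \<alpha>) * B / \<alpha>" "valuation inst 1 (insert (Suc K) {..K}) = B / \<alpha>"
proof -
  have "valuation inst 1 {..K} = (\<Sum>k\<le>K. w k * x k) / \<alpha>"
    unfolding valuation_inst sum_divide_distrib by (intro sum.cong) (auto simp: val_def)
  then show 1: "valuation inst 1 {..K} = (1 - \<alpha>) * B / \<alpha>" by (simp add: B_eq)
  then show "valuation inst 1 (insert (Suc K) {..K}) = B / \<alpha>"
    using \<alpha> by (simp add: valuation_inst) (simp add: val_def field_simps)
qed

lemma won_1: "won_items inst profile 1 = {0<..Suc K}"
proof -
  have "j \<in> won_items inst profile 1 \<longleftrightarrow> 0 < j \<and> j \<le> K" if "j \<le> K" for j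
    using that w_pos[OF that] \<alpha> x_0 x_pos[of j]
    by (cases "j = 0") (auto simp: won_items_inst bid_inst val_def)
  moreover have "Suc K \<in> won_items inst profile 1"
    using B_pos \<alpha> by (auto simp: won_items_inst bid_inst val_def)
  moreover have "j \<le> Suc K" if "j \<in> won_items inst profile 1" for j
    using that by (simp add: won_items_inst)
  ultimately have "j \<in> won_items inst profile 1 \<longleftrightarrow> j \<in> {0<..Suc K}" for j
    by (cases "j \<le> K"; cases "j = Suc K") force+
  then show ?thesis by blast
qed

text \<open>Item 0, the only one that bidder 1 loses, has price 0 and hence is worth nothing to
  it.\<close>

lemma valuation_won_1: "valuation inst 1 (won_items inst profile 1) = B / \<alpha>"
proof -
  have "valuation inst 1 {0<..Suc K} = valuation inst 1 (insert (Suc K) {..K})"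
    unfolding valuation_inst
    by (intro sum.mono_neutral_left) (auto simp: val_def x_0 le_Suc_eq)
  then show ?thesis by (simp add: won_1 valuation_1)
qed

lemma valuation_won_0: "valuation inst 0 (won_items inst profile 0) = w 0"
proof -
  have "won_items inst profile 0 = {0}"
    using x_0 x_pos by (subst won_0) force+
  then show ?thesis by (simp add: valuation_inst val_def)
qed

text \<open>Only item \<open>Suc K\<close> has value for bidder 2, whose bid of at most
  \<open>\<alpha> * B\<close> bidder 1 meets with priority.\<close>

lemma valuation_won_2:
  assumes "a 1 = \<alpha>" "a 2 \<le> 1"
  shows "valuation inst 2 (won_items inst a 2) = 0"
proof -
  have "Suc K \<notin> won_items inst a 2"
    using B_pos \<alpha> assms by (auto simp: won_items_inst bid_inst val_def)
  then show ?thesis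
    unfolding valuation_inst by (intro sum.neutral) (auto simp: val_def won_items_inst le_Suc_eq)
qed

section \<open>Equilibrium and welfare of the instance\<close>

lemma mixed_nash_inst: "mixed_nash inst (pure_profile profile)"
proof (rule mixed_nash_pure_profile)
  show "0 \<le> value_of inst i j" for i j
    using val_nonneg by (simp add: inst_def)
  show "profile i \<in> {0..1}" for i
    using \<alpha> by (simp add: profile_def)
  have "payment inst profile i = profile i * valuation inst i (won_items inst profile i)" for i
    by (simp add: payment_def bid_def valuation_def sum_distrib_left)
  \<comment> \<open>Bidder 1 pays \<open>\<alpha> * (B / \<alpha>) = B\<close>, exactly its
    budget.\<close>
  from this[of 1] show "ereal (payment inst profile i) \<le> budget inst i" for i
    using \<alpha> by (auto simp: valuation_won_1)
next
  fix i and y :: real assume i: "i \<in> bidders inst" and y: "y \<in> {0..1}"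
  let ?b = "profile(i := y)"
  consider "i = 0" | "i = 1" | "i = 2" using i by auto
  then show "utility inst ?b i \<le> utility inst profile i"
  proof cases
    case 1
    have "utility inst ?b 0 = (1 - y) * (\<Sum>k | k \<le> K \<and> x k \<le> y. w k)"
      using 1 won_0[of ?b]
      by (auto simp: utility_eq valuation_inst val_def intro!: sum.cong)
    also have "\<dots> \<le> w 0" using y by (intro utility_w) auto
    finally show ?thesis
      using 1 valuation_won_0 by (simp add: utility_eq)
  next
    case 2
    have fin: "won_items inst ?b 1 \<subseteq> insert (Suc K) {..K}"
      by (auto simp: won_items_inst)
    \<comment> \<open>Below \<open>\<alpha>\<close> the item \<open>Suc K\<close> is lost, and the
      others are worth no more than this bound even for free. From \<open>\<alpha>\<close> on, at
      most the fraction \<open>1 - \<alpha>\<close> of at most \<open>B / \<alpha>\<close> is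
      kept.\<close>
    have "utility inst ?b 1 \<le> (1 - \<alpha>) * B / \<alpha>"
    proof (cases "y < \<alpha>")
      case True
      have "Suc K \<notin> won_items inst ?b 1"
        using B_pos True 2 by (auto simp: won_items_inst bid_inst val_def)
      then have "valuation inst 1 (won_items inst ?b 1) \<le> valuation inst 1 {..K}"
        unfolding valuation_inst using fin val_nonneg by (intro sum_mono2) auto
      moreover have "0 \<le> valuation inst 1 (won_items inst ?b 1)"
        unfolding valuation_inst by (intro sum_nonneg val_nonneg)
      ultimately have "(1 - y) * valuation inst 1 (won_items inst ?b 1) \<le> 1 * valuation inst 1 {..K}"
        using y by (intro mult_mono) auto
      then show ?thesis
        using 2 by (simp add: utility_eq valuation_1)
    next
      case False
      have "valuation inst 1 (won_items inst ?b 1) \<le> valuation inst 1 (insert (Suc K) {..K})"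
        unfolding valuation_inst using fin val_nonneg by (intro sum_mono2) auto
      then have "(1 - y) * valuation inst 1 (won_items inst ?b 1) \<le> (1 - \<alpha>) * (B / \<alpha>)"
        unfolding valuation_1 using y False B_pos \<alpha>
        by (intro mult_mono) (auto simp: valuation_inst intro!: sum_nonneg val_nonneg)
      then show ?thesis
        using 2 by (simp add: utility_eq)
    qed
    also have "\<dots> = utility inst profile 1"
      using valuation_won_1 by (simp add: utility_eq)
    finally show ?thesis using 2 by simp
  next
    case 3
    then show ?thesis
      using y valuation_won_2[of ?b] valuation_won_2[of profile]
      by (simp add: utility_eq)
  qed
qed

lemma liquid_welfare_inst: "liquid_welfare inst (pure_profile profile) = ereal (w 0 + B)"
proof -
  have "expect inst (pure_profile profile) (\<lambda>a. valuation inst i (won_items inst a i)) =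
      valuation inst i (won_items inst profile i)" if "i \<in> bidders inst" for i
    using \<alpha> that by (intro expect_pure_outcomes) auto
  \<comment> \<open>The value won by bidder 1 counts only up to its budget.\<close>
  moreover have "B \<le> B / \<alpha>" using \<alpha> B_pos by (simp add: field_simps)
  ultimately show ?thesis
    using valuation_won_2[of profile] valuation_won_0 valuation_won_1
    by (simp add: liquid_welfare_def min_def)
qed

lemma opt_liquid_welfare_inst: "ereal (1 + B) \<le> opt_liquid_welfare inst"
proof -
  \<comment> \<open>Item \<open>Suc K\<close> alone fills the budget of bidder 1. Allocations are
    extensional, hence \<open>restrict\<close>.\<close>
  define z :: "nat \<Rightarrow> nat set" where
    "z = restrict (\<lambda>i. if i = 0 then {..K} else if i = 1 then {Suc K} else {}) {0, 1, 2}"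
  have "z \<in> allocations inst"
    by (auto simp: allocations_def z_def disjoint_family_on_def)
  moreover have "valuation inst 0 (z 0) = 1" "valuation inst 1 (z 1) = B" "valuation inst 2 (z 2) = 0"
    using sum_w by (simp_all add: valuation_inst z_def val_def)
  ultimately show ?thesis
    using opt_liquid_welfare_ge[of z inst] by (simp add: add.assoc zero_ereal_def one_ereal_def)
qed

lemma price_of_anarchy_inst: "ereal ((1 + B) / (w 0 + B)) \<le> price_of_anarchy"
proof -
  have pos: "0 < w 0 + B" using w_pos[of 0] B_pos by simp
  then have "ereal ((1 + B) / (w 0 + B)) = ereal (1 + B) / ereal (w 0 + B)" by simp
  also have "\<dots> \<le> opt_liquid_welfare inst / ereal (w 0 + B)"
    using pos by (intro ereal_divide_right_mono opt_liquid_welfare_inst) simp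
  also have "\<dots> \<le> price_of_anarchy"
    using price_of_anarchy_ge[OF valid_inst mixed_nash_inst] by (simp add: liquid_welfare_inst)
  finally show ?thesis .
qed

end

section \<open>The limit\<close>

text \<open>
  The prices are geometric, \<open>1 - q\<^sup>-\<^sup>k\<close> with \<open>q\<^sup>K = 1 / u\<close>, and the items at prices up to
  \<open>1 - q\<^sup>-\<^sup>k\<close> have value \<open>u q\<^sup>k\<close>.
\<close>

lemma price_of_anarchy_ge_geometric:
  fixes L :: real
  assumes L: "0 < L"
  defines "q \<equiv> \<lambda>n::nat. exp (L / real (Suc n))"
  defines "B \<equiv> \<lambda>n. (1 - exp (- L) - exp (- L) * real (Suc n) * (1 - 1 / q n)) / (1 - 1 / real (n + 2))"
  shows "ereal ((1 + B n) / (exp (- L) + B n)) \<le> price_of_anarchy"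
proof -
  define u where "u = exp (- L)"
  define w where "w k = (if k = 0 then u else u * (q n ^ k - q n ^ (k - 1)))" for k
  define x where "x k = 1 - 1 / q n ^ k" for k
  have q: "1 < q n" unfolding q_def using L by simp
  have qpos: "0 < q n" using q by simp
  have u: "0 < u" by (simp add: u_def)
  have qK: "u * q n ^ Suc n = 1"
    unfolding u_def q_def exp_of_nat_mult[symmetric] exp_add[symmetric] by simp
  have sum: "(\<Sum>k\<le>m. w k) = u * q n ^ m" for m
    by (induction m) (auto simp: w_def algebra_simps)
  have sum_wx: "(\<Sum>k\<le>m. w k * x k) = u * (q n ^ m - 1) - u * real m * (1 - 1 / q n)" for m
  proof (induction m)
    case (Suc m)
    \<comment> \<open>For geometric prices the gap between value and price,
      \<open>w k * (1 - x k)\<close>, is the same for every item after item 0, so the sum is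
      explicit.\<close>
    have "w (Suc m) * x (Suc m) = u * (q n ^ Suc m - q n ^ m) - u * (1 - 1 / q n)"
      using qpos by (simp add: w_def x_def field_simps)
    then show ?case using Suc by (simp add: algebra_simps)
  qed (simp add: w_def x_def)
  have w_pos: "0 < w k" for k
    using u q by (auto simp: w_def intro!: mult_pos_pos power_strict_increasing)
  have x_pos: "0 < x k" if "0 < k" for k
    using that q by (simp add: x_def one_less_power)
  have x_0: "x 0 = 0" by (simp add: x_def)
  have B: "(\<Sum>k\<le>Suc n. w k * x k) = (1 - 1 / real (n + 2)) * B n"
    unfolding sum_wx B_def u_def[symmetric] right_diff_distrib[of u "q n ^ _"] qK by simp
  \<comment> \<open>The sign of \<open>B n\<close> is read off the sum, not off the closed
    form.\<close>
  have "0 < (\<Sum>k\<le>Suc n. w k * x k)"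
  proof (rule sum_pos2[of _ "Suc n"])
    show "0 \<le> w k * x k" for k
      using w_pos[of k] x_pos[of k] x_0 by (cases "k = 0") auto
  qed (use w_pos x_pos in auto)
  then have B_pos: "0 < B n"
    unfolding B by (simp add: zero_less_mult_iff)
  \<comment> \<open>The multiplier of bidder 1 has to vanish in the limit; \<open>n + 2\<close>
    keeps it below 1 at \<open>n = 0\<close>.\<close>
  interpret lower_bound_instance "Suc n" w x "1 / real (n + 2)" "B n"
  proof
    show "(\<Sum>k\<le>Suc n. w k) = 1" unfolding sum by (rule qK)
    fix \<beta> :: real assume \<beta>: "0 \<le> \<beta>" "\<beta> \<le> 1"
    let ?S = "{k. k \<le> Suc n \<and> x k \<le> \<beta>}"
    \<comment> \<open>For the last item \<open>m\<close> of price at most \<open>\<beta>\<close>,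
      the value sum is at most \<open>u * q n ^ m\<close>, while
      \<open>1 - \<beta> \<le> 1 - x m = 1 / q n ^ m\<close>; the powers cancel.\<close>
    define m where "m = Max ?S"
    have "0 \<in> ?S" using \<beta> x_0 by simp
    then have m: "m \<in> ?S" unfolding m_def by (intro Max_in) auto
    have "(\<Sum>k\<in>?S. w k) \<le> (\<Sum>k\<le>m. w k)"
      unfolding m_def using less_imp_le[OF w_pos] by (intro sum_mono2) auto
    also have "\<dots> = u * q n ^ m" by (rule sum)
    finally have "(1 - \<beta>) * (\<Sum>k\<in>?S. w k) \<le> (1 - x m) * (u * q n ^ m)"
      using m \<beta> less_imp_le[OF w_pos] by (intro mult_mono sum_nonneg) (auto simp: x_def qpos less_imp_le)
    also have "\<dots> = w 0" using qpos by (simp add: x_def w_def)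
    finally show "(1 - \<beta>) * (\<Sum>k\<in>?S. w k) \<le> w 0" .
  qed (use w_pos x_pos x_0 B_pos B in auto)
  show ?thesis using price_of_anarchy_inst by (simp add: w_def u_def)
qed

theorem theorem4p4:
  shows "ereal ((2 + lambert_W0 (- exp (- 2))) / (1 + lambert_W0 (- exp (- 2))))
           \<le> price_of_anarchy"
proof -
  define u where "u = - lambert_W0 (- exp (- 2))"
  have "- u \<in> {- 1..<0} \<and> - u * exp (- u) = - exp (- 2)"
    unfolding u_def minus_minus lambert_W0_arg(3) by (rule theI'[OF lambert_W0_arg(2)])
  then have u: "0 < u" "u \<le> 1" "u * exp (- u) = exp (- 2)" by auto
  have "u \<noteq> 1" using u(3) by auto
  then have u1: "u < 1" using u by simp
  \<comment> \<open>The Lambert equation reads \<open>ln u = u - 2\<close>, so this \<open>L\<close>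
    is \<open>- ln u\<close>.\<close>
  define L where "L = 2 - u"
  have L: "0 < L" using u1 by (simp add: L_def)
  have "u * exp (- u) * exp u = exp (- 2) * exp u" by (simp add: u(3))
  then have uL: "exp (- L) = u"
    by (simp add: L_def mult.assoc exp_add[symmetric] add.commute)
  define B where "B n = (1 - exp (- L) - exp (- L) * real (Suc n) * (1 - 1 / exp (L / real (Suc n)))) /
      (1 - 1 / real (n + 2))" for n :: nat
  \<comment> \<open>Here \<open>(n + 1) * (1 - exp (- L / (n + 1)))\<close> tends to
    \<open>L\<close>.\<close>
  have lim: "B \<longlonglongrightarrow> 1 - u - u * L"
    unfolding B_def uL using L by real_asymp
  \<comment> \<open>The choice of \<open>u\<close> makes the limiting denominator a square, one
    factor of which cancels against the numerator.\<close>
  have pos: "u + (1 - u - u * L) = (1 - u)\<^sup>2" by (simp add: L_def power2_eq_square algebra_simps)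
  have "(\<lambda>n. (1 + B n) / (u + B n)) \<longlonglongrightarrow> (1 + (1 - u - u * L)) / (u + (1 - u - u * L))"
    using u1 pos by (intro tendsto_intros lim) simp
  also have "1 + (1 - u - u * L) = (2 - u) * (1 - u)" by (simp add: L_def algebra_simps)
  also have "(2 - u) * (1 - u) / (u + (1 - u - u * L)) = (2 - u) / (1 - u)"
    unfolding pos using u1 by (simp add: power2_eq_square)
  finally have limit: "(\<lambda>n. ereal ((1 + B n) / (u + B n))) \<longlonglongrightarrow> ereal ((2 - u) / (1 - u))" by simp
  moreover have "ereal ((1 + B n) / (u + B n)) \<le> price_of_anarchy" for n
    using price_of_anarchy_ge_geometric[OF L, of n] by (simp only: B_def uL)
  ultimately have "ereal ((2 - u) / (1 - u)) \<le> price_of_anarchy"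
    using LIMSEQ_le_const2[OF limit] by blast
  then show ?thesis by (simp add: u_def)
qed

end
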